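(* For infinitely many $N$, there are $N\times N$ matrices $A,B$ with entries in $\{0,1\}$ such that: (1) every row of $A$ and every column of $B$ has a run-length encoding (and hence a grammar compression) of size $O(\log N)$, so the convenient compression of $(A,B)$ has size $O(N\log N)$; (2) $A$ and $B$ each have a strong compression of size $O(\log^2 N)$; (3) the product $C=AB$ (over the integers) has size $\Omega(N^2/\log^2 N)$ in any grammar compression: every row-wise compression of $C$, every column-wise compression of $C$, and every strong compression of $C$ has size $\Omega(N^2/\log^2 N)$.
   Context: A straight-line program (SLP), or grammar compression, of a string over an alphabet $\Sigma$ is a sequence of rules $S_1,\dots,S_n$, each either $S_i\to\sigma$ with $\sigma\in\Sigma$ or $S_i\to S_jS_k$ with $j,k<i$; it generates the string of its last rule, and its size is $n$. A run-length encoding replaces each maximal run of equal symbols by a (symbol, length) pair; its size is the number of runs. For an $N\times N$ matrix $M$: the convenient compression of a pair $(A,B)$ consists of a grammar compression of each row of $A$ and each column of $B$, its size being the total size; a row-wise (resp. column-wise) compression of $M$ consists of a grammar compression of each row (resp. column) of $M$, its size being the total size of these grammars; a strong compression of $M$ is a grammar compression of $M$ or of $M^T$ viewed as an $N^2$-dimensional vector (concatenation of rows), whichever is shorter. *)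

theory Defs
  imports Complex_Main "HOL-Library.Infinite_Set" "Jordan_Normal_Form.Matrix"
begin

datatype 'a slp_rule = Terminal 'a | Concat nat nat

type_synonym 'a slp = "'a slp_rule list"

text \<open>Rules are numbered from \<open>0\<close>; the last rule is the start symbol.\<close>

definition is_slp :: "'a slp \<Rightarrow> bool" where
  "is_slp G \<longleftrightarrow> G \<noteq> [] \<and>
     (\<forall>i < length G. \<forall>j k. G ! i = Concat j k \<longrightarrow> j < i \<and> k < i)"

inductive rule_yields :: "'a slp \<Rightarrow> nat \<Rightarrow> 'a list \<Rightarrow> bool" for G where
  Terminal: "i < length G \<Longrightarrow> G ! i = Terminal a \<Longrightarrow> rule_yields G i [a]"
| Concat: "i < length G \<Longrightarrow> G ! i = Concat j k \<Longrightarrow>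
    rule_yields G j u \<Longrightarrow> rule_yields G k v \<Longrightarrow> rule_yields G i (u @ v)"

definition grammar_compression :: "'a list \<Rightarrow> 'a slp \<Rightarrow> bool" where
  "grammar_compression w G \<longleftrightarrow> is_slp G \<and> rule_yields G (length G - 1) w"

definition slp_size :: "'a slp \<Rightarrow> nat" where
  "slp_size G = length G"

definition total_size :: "'a slp list \<Rightarrow> nat" where
  "total_size Gs = sum_list (map slp_size Gs)"

definition run_length_encoding :: "'a list \<Rightarrow> ('a \<times> nat) list \<Rightarrow> bool" where
  "run_length_encoding w ps \<longleftrightarrow>
     w = concat (map (\<lambda>(a, l). replicate l a) ps) \<and>
     (\<forall>(a, l) \<in> set ps. l > 0) \<and> distinct_adj (map fst ps)"

definition rle_size :: "('a \<times> nat) list \<Rightarrow> nat" where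
  "rle_size ps = length ps"

definition rowwise_compression :: "'a mat \<Rightarrow> 'a slp list \<Rightarrow> bool" where
  "rowwise_compression M Gs \<longleftrightarrow>
     list_all2 grammar_compression (map list_of_vec (rows M)) Gs"

definition columnwise_compression :: "'a mat \<Rightarrow> 'a slp list \<Rightarrow> bool" where
  "columnwise_compression M Gs \<longleftrightarrow>
     list_all2 grammar_compression (map list_of_vec (cols M)) Gs"

definition convenient_compression ::
    "'a mat \<Rightarrow> 'a mat \<Rightarrow> 'a slp list \<times> 'a slp list \<Rightarrow> bool" where
  "convenient_compression A B P \<longleftrightarrow>
     rowwise_compression A (fst P) \<and> columnwise_compression B (snd P)"

definition convenient_size :: "'a slp list \<times> 'a slp list \<Rightarrow> nat" where
  "convenient_size P = total_size (fst P) + total_size (snd P)"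

definition row_concatenation :: "'a mat \<Rightarrow> 'a list" where
  "row_concatenation M = concat (map list_of_vec (rows M))"

text \<open>The shorter of a compression \<open>G\<close> of \<open>M\<close> and a compression \<open>H\<close> of its transpose.
  Neither is required to be a smallest grammar.\<close>

definition strong_compression :: "'a mat \<Rightarrow> 'a slp \<Rightarrow> bool" where
  "strong_compression M S \<longleftrightarrow>
     (\<exists>G H. grammar_compression (row_concatenation M) G \<and>
            grammar_compression (row_concatenation (transpose_mat M)) H \<and>
            S \<in> {G, H} \<and> slp_size S = min (slp_size G) (slp_size H))"

end

theory Submission imports Defs begin

text \<open>Let \<open>N = 2 ^ (m + 1)\<close>, and let the height \<open>h i\<close> be \<open>i div 2\<close> for odd \<open>i\<close> and \<open>0\<close> for
  even \<open>i\<close>. Writing each bit \<open>b\<close> of \<open>h i\<close> out \<open>2 ^ b\<close> times gives a row half with \<open>h i\<close> ones and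
  only \<open>O(log N)\<close> runs, while each column of the resulting matrix is periodic and has a grammar of
  size \<open>O(log N)\<close>. Padding with ones on the right for \<open>A\<close>, and on the left for the transpose of
  \<open>B\<close>, makes the product the matrix with entries \<open>h i + h j\<close>.

  Each concatenation rule creates only one new pair of adjacent letters, where its two parts meet,
  so a grammar has at least as many rules as its string has distinct letters, or distinct pairs
  of adjacent letters. Each row of the product has at least \<open>N / 2\<close> distinct entries. Since \<open>h\<close>
  vanishes at every other index, horizontal neighbours in the product form at least \<open>N\<^sup>2 / 4\<close>
  distinct pairs. The product is symmetric, so columns need no separate argument.\<close>

section \<open>Lower bounds for grammars\<close>

text \<open>The rule at \<open>i\<close> fixes how any expansion splits. This is what limits a rule
  to a single seam below.\<close>

lemma rule_yields_functional:
  "rule_yields G i u \<Longrightarrow> rule_yields G i v \<Longrightarrow> u = v"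
proof (induction arbitrary: v rule: rule_yields.induct)
  case (Terminal i a)
  from Terminal.prems Terminal.hyps(2) show ?case by cases auto
next
  case (Concat i j k u1 u2)
  from Concat.prems Concat.hyps(2) obtain v1 v2
    where "v = v1 @ v2" "rule_yields G j v1" "rule_yields G k v2"
    by cases auto
  then show ?case using Concat.IH by blast
qed

lemma rule_yields_nonempty: "rule_yields G i w \<Longrightarrow> w \<noteq> []"
  by (induction rule: rule_yields.induct) auto

lemma rule_yields_letters:
  "rule_yields G i w \<Longrightarrow> set w \<subseteq> {a. Terminal a \<in> set G}"
  by (induction rule: rule_yields.induct) (auto simp: in_set_conv_nth)

text \<open>Each letter of \<open>w\<close> comes from a rule \<open>Terminal a\<close>, and
  distinct letters need distinct rules.\<close>

lemma grammar_size_ge_letters: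
  assumes "grammar_compression w G"
  shows "card (set w) \<le> slp_size G"
proof -
  \<comment> \<open>The \<open>case\<close> is unspecified on \<open>Concat\<close>, which is
    harmless: the set only has to lie inside the image of \<open>set G\<close>.\<close>
  have fin: "finite {a. Terminal a \<in> set G}"
    by (rule finite_surj[of "set G" _ "\<lambda>r. case r of Terminal a \<Rightarrow> a"]) force+
  have "card (set w) \<le> card {a. Terminal a \<in> set G}"
    using assms rule_yields_letters[of G "length G - 1" w] fin
    by (auto simp: grammar_compression_def intro!: card_mono)
  also have "\<dots> = card (Terminal ` {a. Terminal a \<in> set G})"
    by (simp add: card_image inj_on_def)
  also have "\<dots> \<le> card (set G)"
    by (intro card_mono) auto
  also have "\<dots> \<le> slp_size G"
    by (simp add: slp_size_def card_length)
  finally show ?thesis .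
qed

section \<open>Distinct adjacent pairs as a lower bound on grammar size\<close>

definition adjacent_pairs :: "'a list \<Rightarrow> ('a \<times> 'a) set" where
  "adjacent_pairs w = {(w ! p, w ! Suc p) |p. Suc p < length w}"

lemma finite_adjacent_pairs: "finite (adjacent_pairs w)"
  by (rule finite_subset[of _ "(\<lambda>p. (w ! p, w ! Suc p)) ` {..<length w}"])
     (auto simp: adjacent_pairs_def)

lemma adjacent_pairs_append_subset:
  assumes "u \<noteq> []" "v \<noteq> []"
  shows "adjacent_pairs (u @ v) \<subseteq>
    adjacent_pairs u \<union> adjacent_pairs v \<union> {(last u, hd v)}"
proof
  fix x assume "x \<in> adjacent_pairs (u @ v)"
  then obtain p where p: "x = ((u @ v) ! p, (u @ v) ! Suc p)" "Suc p < length u + length v"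
    by (auto simp: adjacent_pairs_def)
  consider "Suc p < length u" | "Suc p = length u" | "Suc p > length u" by linarith
  then show "x \<in> adjacent_pairs u \<union> adjacent_pairs v \<union> {(last u, hd v)}"
  proof cases
    case 1
    then show ?thesis using p by (auto simp: adjacent_pairs_def nth_append)
  next
    case 2
    then have "p = length u - 1" by simp
    then show ?thesis using p 2 assms
      by (auto simp: nth_append last_conv_nth hd_conv_nth)
  next
    case 3
    then have "x = (v ! (p - length u), v ! Suc (p - length u))"
      "Suc (p - length u) < length v"
      using p by (auto simp: nth_append Suc_diff_le)
    then show ?thesis by (auto simp: adjacent_pairs_def)
  qed
qed

text \<open>The pair formed where the two parts of a rule meet. A set allows for terminal rules, and
  for concatenations whose parts have no expansion, to have none.\<close>

definition seam :: "'a slp \<Rightarrow> nat \<Rightarrow> ('a \<times> 'a) set" where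
  "seam G i = {(last u, hd v) |u v j k. G ! i = Concat j k \<and> rule_yields G j u \<and> rule_yields G k v}"

lemma seam_at_most_one: "\<exists>x. seam G i \<subseteq> {x}"
proof (cases "seam G i = {}")
  case False
  then obtain x where "x \<in> seam G i" by auto
  then have "seam G i \<subseteq> {x}"
    by (auto simp: seam_def dest: rule_yields_functional)
  then show ?thesis ..
qed auto

text \<open>A single letter has no pairs, and a concatenation adds only its own seam to the pairs of
  its two parts, which induction already covers.\<close>

lemma rule_yields_adjacent_pairs:
  "rule_yields G i w \<Longrightarrow> adjacent_pairs w \<subseteq> (\<Union>i<length G. seam G i)"
proof (induction rule: rule_yields.induct)
  case (Terminal i a)
  then show ?case by (simp add: adjacent_pairs_def)
next
  case (Concat i j k u v)
  have "(last u, hd v) \<in> seam G i"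
    using Concat.hyps by (auto simp: seam_def)
  then show ?case
    using adjacent_pairs_append_subset[of u v] Concat rule_yields_nonempty by fastforce
qed

text \<open>Union bound over the rules, each supplying at most one seam however often it is used in
  the expansion.\<close>

lemma grammar_size_ge_adjacent_pairs:
  assumes "grammar_compression w G"
  shows "card (adjacent_pairs w) \<le> slp_size G"
proof -
  have le1: "finite (seam G i) \<and> card (seam G i) \<le> 1" for i
    using seam_at_most_one[of G i] card_mono[of "{x}" "seam G i" for x]
    by (metis card.empty card_insert_disjoint finite.emptyI finite_insert finite_subset
        insert_absorb One_nat_def insert_not_empty le_numeral_extra(4))
  have "card (adjacent_pairs w) \<le> card (\<Union>i<length G. seam G i)"
    using assms rule_yields_adjacent_pairs[of G _ w] le1
    by (intro card_mono) (auto simp: grammar_compression_def)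
  also have "\<dots> \<le> (\<Sum>i<length G. card (seam G i))"
    by (rule card_UN_le) simp
  also have "\<dots> \<le> (\<Sum>i<length G. 1)"
    using le1 by (intro sum_mono) auto
  finally show ?thesis by (simp add: slp_size_def)
qed

section \<open>Building grammars\<close>

text \<open>A straight-line program with at most \<open>n\<close> rules in which every string of \<open>V\<close> is the
  expansion of some rule; abstracting from rule numbers makes grammars composable.\<close>

inductive derives :: "nat \<Rightarrow> 'a list set \<Rightarrow> bool" where
  empty: "derives 0 {}"
| letter: "derives n V \<Longrightarrow> derives (Suc n) (insert [a] V)"
| append: "derives n V \<Longrightarrow> u \<in> V \<Longrightarrow> v \<in> V \<Longrightarrow> derives (Suc n) (insert (u @ v) V)"
| weaken: "derives n V \<Longrightarrow> n \<le> n' \<Longrightarrow> V' \<subseteq> V \<Longrightarrow> derives n' V'"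

section \<open>From derivations to grammars\<close>

lemma rule_yields_append:
  "rule_yields G i w \<Longrightarrow> rule_yields (G @ G') i w"
  by (induction rule: rule_yields.induct)
     (auto intro: rule_yields.intros simp: nth_append)

text \<open>A rule refers only to earlier ones, so its expansion survives when later rules are cut
  off. This allows any rule to be made the start symbol.\<close>

lemma rule_yields_take:
  assumes "\<forall>i < length G. \<forall>j k. G ! i = Concat j k \<longrightarrow> j < i \<and> k < i"
  shows "rule_yields G i w \<Longrightarrow> i < n \<Longrightarrow> rule_yields (take n G) i w"
proof (induction rule: rule_yields.induct)
  case (Terminal i a)
  then show ?case by (auto intro: rule_yields.Terminal)
next
  case (Concat i j k u v)
  then have "j < i" "k < i" using assms by blast+
  then show ?case using Concat by (intro rule_yields.Concat[of i _ j k]) auto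
qed

lemma derives_rules:
  "derives n V \<Longrightarrow> \<exists>G. length G \<le> n \<and>
     (\<forall>i < length G. \<forall>j k. G ! i = Concat j k \<longrightarrow> j < i \<and> k < i) \<and>
     (\<forall>w \<in> V. \<exists>i. rule_yields G i w)"
proof (induction rule: derives.induct)
  case empty
  then show ?case by (intro exI[of _ "[]"]) auto
next
  case (letter n V a)
  then obtain G where G: "length G \<le> n"
    "\<forall>i < length G. \<forall>j k. G ! i = Concat j k \<longrightarrow> j < i \<and> k < i"
    "\<forall>w \<in> V. \<exists>i. rule_yields G i w" by blast
  let ?G = "G @ [Terminal a]"
  have "rule_yields ?G (length G) [a]" by (rule rule_yields.Terminal) auto
  then have "\<forall>w \<in> insert [a] V. \<exists>i. rule_yields ?G i w"
    using G(3) rule_yields_append by blast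
  moreover have "\<forall>i < length ?G. \<forall>j k. ?G ! i = Concat j k \<longrightarrow> j < i \<and> k < i"
    using G(2) by (auto simp: nth_append split: if_splits)
  ultimately show ?case using G(1) by (intro exI[of _ ?G]) auto
next
  case (append n V u v)
  then obtain G where G: "length G \<le> n"
    "\<forall>i < length G. \<forall>j k. G ! i = Concat j k \<longrightarrow> j < i \<and> k < i"
    "\<forall>w \<in> V. \<exists>i. rule_yields G i w" by blast
  obtain j k where jk: "rule_yields G j u" "rule_yields G k v"
    using G(3) append.hyps by blast
  then have lt: "j < length G" "k < length G" by (auto elim: rule_yields.cases)
  let ?G = "G @ [Concat j k]"
  have "rule_yields ?G (length G) (u @ v)"
    by (rule rule_yields.Concat) (use jk rule_yields_append in auto)
  then have "\<forall>w \<in> insert (u @ v) V. \<exists>i. rule_yields ?G i w"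
    using G(3) rule_yields_append by blast
  moreover have "\<forall>i < length ?G. \<forall>j k. ?G ! i = Concat j k \<longrightarrow> j < i \<and> k < i"
    using G(2) lt by (auto simp: nth_append split: if_splits)
  ultimately show ?case using G(1) by (intro exI[of _ ?G]) auto
next
  case (weaken n V n' V')
  then show ?case by (meson order_trans subsetD)
qed

lemma derives_grammar:
  assumes "derives n V" "w \<in> V"
  shows "\<exists>G. grammar_compression w G \<and> slp_size G \<le> n"
proof -
  obtain G i where G: "length G \<le> n"
    "\<forall>i < length G. \<forall>j k. G ! i = Concat j k \<longrightarrow> j < i \<and> k < i"
    "rule_yields G i w"
    using derives_rules[OF assms(1)] assms(2) by blast
  then have i: "i < length G" by (auto elim: rule_yields.cases)
  let ?G = "take (Suc i) G"
  have "rule_yields ?G i w" using rule_yields_take[OF G(2,3)] by simp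
  moreover have "length ?G - 1 = i" using i by simp
  moreover have "is_slp ?G" using G(2) i by (auto simp: is_slp_def)
  ultimately show ?thesis using G(1)
    by (intro exI[of _ ?G]) (auto simp: grammar_compression_def slp_size_def)
qed

text \<open>The second derivation is replayed on top of the first.\<close>

lemma derives_union:
  assumes "derives n V"
  shows "derives p X \<Longrightarrow> derives (n + p) (V \<union> X)"
proof (induction rule: derives.induct)
  case empty
  then show ?case using assms by simp
next
  case (letter p X a)
  then show ?case using derives.letter[of "n + p" "V \<union> X" a] by simp
next
  case (append p X u v)
  then show ?case using derives.append[of "n + p" "V \<union> X" u v] by simp
next
  case (weaken p X p' X')
  then show ?case by (meson Un_mono add_left_mono derives.weaken order_refl)
qed

lemma derives_UN:
  assumes "\<And>x. x \<in> set xs \<Longrightarrow> derives n (V x)"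
  shows "derives (n * length xs) (\<Union>x \<in> set xs. V x)"
  using assms
proof (induction xs)
  case Nil
  then show ?case by (simp add: derives.empty)
next
  case (Cons x xs)
  then show ?case using derives_union[of n "V x" "n * length xs" "\<Union>x \<in> set xs. V x"] by simp
qed

text \<open>The strings are joined from the right with at most one rule each; intermediate suffixes
  are forgotten.\<close>

lemma derives_concat:
  assumes "derives n V" "set us \<subseteq> V" "us \<noteq> []"
  shows "derives (n + length us) (insert (concat us) V)"
  using assms(3,2)
proof (induction us rule: list_nonempty_induct)
  case (single u)
  then show ?case using assms(1) by (auto intro: derives.weaken simp: insert_absorb)
next
  case (cons u us)
  then have "derives (Suc (n + length us)) (insert (u @ concat us) (insert (concat us) V))"
    by (intro derives.append) auto
  then show ?case by (rule derives.weaken) auto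
qed

abbreviation repeat :: "nat \<Rightarrow> 'a list \<Rightarrow> 'a list" where
  "repeat n u \<equiv> concat (replicate n u)"

lemma repeat_add: "repeat (a + b) u = repeat a u @ repeat b u"
  by (simp add: replicate_add)

text \<open>Repeated doubling: each further power of two costs one rule, and all smaller powers stay
  available.\<close>

lemma derives_repeat:
  assumes "derives n V" "u \<in> V"
  shows "derives (n + e) (V \<union> {repeat (2 ^ d) u |d. d \<le> e})"
proof (induction e)
  case 0
  then show ?case using assms by (auto intro: derives.weaken)
next
  case (Suc e)
  let ?V = "V \<union> {repeat (2 ^ d) u |d. d \<le> e}"
  have "repeat (2 ^ e) u \<in> ?V" by auto
  from derives.append[OF Suc this this]
  have "derives (n + Suc e) (insert (repeat (2 ^ Suc e) u) ?V)"
    by (simp add: mult_2 repeat_add)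
  then show ?case by (rule derives.weaken) (auto simp: le_Suc_eq)
qed

lemma derives_repeat_single:
  assumes "derives n {u}"
  shows "derives (n + e) {repeat (2 ^ e) u}"
  using derives_repeat[OF assms, of u e] by (rule derives.weaken) auto

lemma derives_letters: "derives (length w) ((\<lambda>a. [a]) ` set w)"
  by (induction w) (auto intro: derives.intros)

text \<open>Spelling out \<open>w\<close> letter by letter suffices. A strong compression refers to
  grammars for both orientations, and this crude one serves for the orientation that is not
  compressed well.\<close>

lemma grammar_compression_exists:
  assumes "w \<noteq> []"
  shows "\<exists>G. grammar_compression w G"
proof -
  have "derives (length w + length w) (insert w ((\<lambda>a. [a]) ` set w))"
    using derives_concat[OF derives_letters, of "map (\<lambda>a. [a]) w" w] assms by (simp add: concat_map_singleton)
  then show ?thesis using derives_grammar by blast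
qed

section \<open>Run-length encodings with runs of length a power of two\<close>

text \<open>\<open>qs\<close> may contain empty runs and equal neighbours; dropping the former and
  merging the latter never increases the number of runs.\<close>

lemma run_length_encoding_exists:
  "\<exists>ps. run_length_encoding (concat (map (\<lambda>(a, l). replicate l a) qs)) ps \<and>
     rle_size ps \<le> length qs"
proof (induction qs)
  case Nil
  then show ?case by (intro exI[of _ "[]"]) (auto simp: run_length_encoding_def rle_size_def)
next
  case (Cons q qs)
  obtain a l where q: "q = (a, l)" by fastforce
  obtain ps where ps: "run_length_encoding (concat (map (\<lambda>(a, l). replicate l a) qs)) ps"
    "rle_size ps \<le> length qs" using Cons by blast
  show ?case
  proof (cases "l = 0")
    case True
    then show ?thesis using ps q by (intro exI[of _ ps]) auto
  next
    case l: False
    show ?thesis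
    proof (cases ps)
      case Nil
      then show ?thesis using ps q l
        by (intro exI[of _ "[(a, l)]"]) (auto simp: run_length_encoding_def rle_size_def)
    next
      case (Cons p ps')
      obtain b l' where p: "p = (b, l')" by fastforce
      show ?thesis
      proof (cases "a = b")
        case True
        then show ?thesis using ps q l Cons p
          by (intro exI[of _ "(a, l + l') # ps'"])
             (auto simp: run_length_encoding_def rle_size_def replicate_add distinct_adj_Cons)
      next
        case False
        then show ?thesis using ps q l Cons p
          by (intro exI[of _ "(a, l) # ps"])
             (auto simp: run_length_encoding_def rle_size_def)
      qed
    qed
  qed
qed

text \<open>Runs carry exponents because doubling makes a run of length \<open>2 ^ e\<close> cheap.
  The entries are either letters of a row or whole column functions.\<close>

definition dyadic_expand :: "('a \<times> nat) list \<Rightarrow> 'a list" where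
  "dyadic_expand rs = concat (map (\<lambda>(a, e). replicate (2 ^ e) a) rs)"

lemma dyadic_expand_simps [simp]:
  "dyadic_expand [] = []"
  "dyadic_expand ((a, e) # rs) = replicate (2 ^ e) a @ dyadic_expand rs"
  "dyadic_expand (rs @ rs') = dyadic_expand rs @ dyadic_expand rs'"
  by (auto simp: dyadic_expand_def)

text \<open>With \<open>f\<close> the evaluation at a row index, a list of columns becomes a row
  with the same exponents.\<close>

lemma map_dyadic_expand: "map f (dyadic_expand rs) = dyadic_expand (map (apfst f) rs)"
  by (induction rs) auto

lemma concat_map_dyadic_expand:
  "concat (map f (dyadic_expand rs)) = concat (map (\<lambda>(a, e). repeat (2 ^ e) (f a)) rs)"
  by (induction rs) auto

lemma set_dyadic_expand: "set (dyadic_expand rs) = fst ` set rs"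
  by (force simp: dyadic_expand_def)

lemma rle_dyadic_expand:
  "\<exists>ps. run_length_encoding (dyadic_expand rs) ps \<and> rle_size ps \<le> length rs"
  using run_length_encoding_exists[of "map (\<lambda>(a, e). (a, 2 ^ e)) rs"]
  by (simp add: dyadic_expand_def o_def case_prod_unfold)

text \<open>For each letter, \<open>m + 1\<close> rules give all its dyadic runs up to exponent
  \<open>m\<close>; at most one more rule per run joins them.\<close>

lemma grammar_dyadic_expand:
  fixes rs :: "('a \<times> nat) list"
  assumes "rs \<noteq> []" "set rs \<subseteq> set as \<times> {..m}"
  shows "\<exists>G. grammar_compression (dyadic_expand rs) G \<and>
    slp_size G \<le> (m + 1) * length as + length rs"
proof -
  let ?V = "\<lambda>a :: 'a. {repeat (2 ^ d) [a] |d. d \<le> m}"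
  have "derives (m + 1) (?V a)" for a
  proof -
    have "derives (Suc 0) {[a]}" by (rule derives.letter[OF derives.empty])
    from derives_repeat[OF this, of "[a]" m] show ?thesis
      by (rule derives.weaken) auto
  qed
  then have V: "derives ((m + 1) * length as) (\<Union>a \<in> set as. ?V a)"
    by (intro derives_UN) auto
  have "derives ((m + 1) * length as + length (map (\<lambda>(a, e). repeat (2 ^ e) [a]) rs))
    (insert (concat (map (\<lambda>(a, e). repeat (2 ^ e) [a]) rs)) (\<Union>a \<in> set as. ?V a))"
    by (rule derives_concat[OF V]) (use assms in fastforce)+
  moreover have "concat (map (\<lambda>(a, e). repeat (2 ^ e) [a]) rs) = dyadic_expand rs"
    using concat_map_dyadic_expand[of "\<lambda>a. [a]" rs] by simp
  ultimately show ?thesis using derives_grammar by fastforce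
qed

section \<open>Matrices given by column functions\<close>

text \<open>Columns are functions of the row index, so a block of equal columns is a dyadic run of
  one function.\<close>

definition column_mat :: "(nat \<Rightarrow> 'a) list \<Rightarrow> 'a mat" where
  "column_mat D = mat (length D) (length D) (\<lambda>(i, c). (D ! c) i)"

lemma column_mat_carrier: "column_mat D \<in> carrier_mat (length D) (length D)"
  by (simp add: column_mat_def)

lemma rows_column_mat:
  "map list_of_vec (rows (column_mat D)) = map (\<lambda>i. map (\<lambda>\<phi>. \<phi> i) D) [0..<length D]"
proof -
  have "list_of_vec (row (column_mat D) i) = map (\<lambda>\<phi>. \<phi> i) D" if "i < length D" for i
    using that by (intro nth_equalityI) (auto simp: column_mat_def)
  then show ?thesis by (auto simp: rows_def column_mat_def)
qed

lemma row_concatenation_transpose_column_mat: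
  "row_concatenation (transpose_mat (column_mat D)) =
     concat (map (\<lambda>\<phi>. map \<phi> [0..<length D]) D)"
proof -
  have "map list_of_vec (rows (transpose_mat (column_mat D))) = map (\<lambda>\<phi>. map \<phi> [0..<length D]) D"
    by (intro nth_equalityI) (auto simp: column_mat_def intro!: nth_equalityI)
  then show ?thesis by (simp add: row_concatenation_def)
qed

text \<open>The two orientations enter the definition symmetrically. This serves the right factor,
  which is built as a transpose.\<close>

lemma strong_compression_transpose:
  assumes "strong_compression M S"
  shows "strong_compression (transpose_mat M) S"
proof -
  obtain G H where "grammar_compression (row_concatenation M) G"
    "grammar_compression (row_concatenation (transpose_mat M)) H"
    "S \<in> {G, H}" "slp_size S = min (slp_size G) (slp_size H)"
    using assms by (auto simp: strong_compression_def)
  then show ?thesis unfolding strong_compression_def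
    by (intro exI[of _ H] exI[of _ G]) (auto simp: min.commute)
qed

text \<open>The shorter of two grammars is never longer than \<open>H\<close>, so any grammar will
  do for the other orientation.\<close>

lemma strong_compression_exists:
  assumes "row_concatenation M \<noteq> []"
    and "grammar_compression (row_concatenation (transpose_mat M)) H"
  shows "\<exists>S. strong_compression M S \<and> slp_size S \<le> slp_size H"
proof -
  obtain G where G: "grammar_compression (row_concatenation M) G"
    using grammar_compression_exists[OF assms(1)] by blast
  let ?S = "if slp_size G \<le> slp_size H then G else H"
  have "strong_compression M ?S"
    unfolding strong_compression_def using G assms(2)
    by (intro exI[of _ G] exI[of _ H]) auto
  then show ?thesis by (intro exI[of _ ?S]) auto
qed

lemma rowwise_compression_of_size:
  assumes "\<And>w. w \<in> set (rows M) \<Longrightarrow> \<exists>G. grammar_compression (list_of_vec w) G \<and> slp_size G \<le> s"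
  shows "\<exists>Gs. rowwise_compression M Gs \<and> total_size Gs \<le> dim_row M * s"
proof -
  obtain g where g: "\<And>w. w \<in> set (rows M) \<Longrightarrow>
      grammar_compression (list_of_vec w) (g w) \<and> slp_size (g w) \<le> s"
    using assms by metis
  have "rowwise_compression M (map g (rows M))"
    unfolding rowwise_compression_def using g
    by (simp add: list_all2_map1 list_all2_map2 list_all2_same)
  moreover have "total_size (map g (rows M)) \<le> sum_list (map (\<lambda>_. s) (rows M))"
    unfolding total_size_def map_map o_def using g by (intro sum_list_mono) auto
  ultimately show ?thesis by (auto simp: sum_list_triv)
qed

section \<open>The column functions of the construction\<close>

text \<open>This is bit \<open>b\<close> of \<open>height i\<close>; the exponent is
  \<open>Suc b\<close> because the height of an odd \<open>i\<close> is already
  \<open>i div 2\<close>.\<close>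

definition bit_column :: "nat \<Rightarrow> nat \<Rightarrow> int" where
  "bit_column b i = of_bool (odd i \<and> odd (i div 2 ^ Suc b))"

text \<open>Repeating column \<open>b\<close> exactly \<open>2 ^ b\<close> times gives the bit its
  weight. The single zero column raises the number of columns from \<open>2 ^ m - 1\<close> to
  \<open>2 ^ m\<close>.\<close>

definition bit_runs :: "nat \<Rightarrow> ((nat \<Rightarrow> int) \<times> nat) list" where
  "bit_runs m = (\<lambda>_. 0, 0) # map (\<lambda>b. (bit_column b, b)) [0..<m]"

definition height :: "nat \<Rightarrow> nat" where
  "height i = (if odd i then i div 2 else 0)"

lemma length_dyadic_expand_bit_runs: "length (dyadic_expand (bit_runs m)) = 2 ^ m"
  by (induction m) (auto simp: bit_runs_def)

lemma sum_list_bit_runs: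
  assumes "i < 2 ^ Suc m"
  shows "sum_list (map (\<lambda>\<phi>. \<phi> i) (dyadic_expand (bit_runs m))) = int (height i)"
proof -
  \<comment> \<open>Stated with \<open>take_bit\<close>, the claim needs no bound on
    \<open>i\<close>, so the induction can add one bit at a time.\<close>
  have "sum_list (map (\<lambda>\<phi>. \<phi> i) (dyadic_expand (bit_runs m))) = int (take_bit m (height i))"
  proof (induction m)
    case 0
    then show ?case by (simp add: bit_runs_def)
  next
    case (Suc m)
    have "bit_column m i = of_bool (bit (height i) m)"
      by (simp add: bit_column_def height_def bit_iff_odd div_mult2_eq)
    then show ?case using Suc
      by (simp add: bit_runs_def map_replicate sum_list_replicate take_bit_Suc_from_most)
  qed
  moreover have "height i < 2 ^ m" using assms by (auto simp: height_def)
  ultimately show ?thesis by (simp add: take_bit_nat_eq_self)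
qed

section \<open>Grammars for the columns\<close>

lemma map_periodic:
  assumes "\<And>i. f (i + p) = f i"
  shows "map f [0..<q * p] = repeat q (map f [0..<p])"
proof (induction q)
  case (Suc q)
  have "f (i + q * p) = f i" for i
  proof (induction q)
    case (Suc q)
    then show ?case using assms[of "i + q * p"] by (simp add: ac_simps)
  qed simp
  then have "map f [q * p..<q * p + p] = map f [0..<p]"
    by (intro nth_equalityI) (auto simp: add.commute)
  moreover have "[0..<Suc q * p] = [0..<q * p] @ [q * p..<q * p + p]"
    using upt_add_eq_append[of 0 "q * p" p] by (simp add: add.commute)
  moreover have "repeat (Suc q) (map f [0..<p]) = repeat q (map f [0..<p]) @ map f [0..<p]"
    using repeat_add[of q 1 "map f [0..<p]"] by simp
  ultimately show ?case using Suc by simp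
qed simp

text \<open>Bit \<open>b\<close> of \<open>i div 2\<close> has period \<open>2 ^ (b + 2)\<close> in
  \<open>i\<close>. It is clear in the first half of a period and set in the second, where the
  column therefore shows the parity of \<open>i\<close>. The \<open>2 ^ Suc m\<close> rows hold
  \<open>2 ^ (m - Suc b)\<close> periods.\<close>

lemma bit_column_list:
  assumes "b < m"
  shows "map (bit_column b) [0..<2 ^ Suc m] =
    repeat (2 ^ (m - Suc b)) (repeat (2 ^ b) [0, 0] @ repeat (2 ^ b) [0, 1])"
proof -
  let ?P = "2 ^ Suc b :: nat"
  have two: "[0..<2] = [0, 1 :: nat]" by (simp add: numeral_2_eq_2)
  have per: "bit_column b (i + 2 * ?P) = bit_column b i" for i
  proof -
    have "(i + 2 * ?P) div ?P = i div ?P + 2" by (subst div_mult_self1) simp_all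
    then show ?thesis by (simp only: bit_column_def) simp
  qed
  have "2 ^ Suc m = 2 ^ (m - Suc b) * (2 * ?P)"
    using assms by (simp add: power_add[symmetric] flip: power_Suc)
  then have "map (bit_column b) [0..<2 ^ Suc m] =
      repeat (2 ^ (m - Suc b)) (map (bit_column b) [0..<2 * ?P])"
    using map_periodic[of "bit_column b" "2 * ?P", OF per] by metis
  moreover have "[0..<2 * ?P] = [0..<?P] @ [?P..<?P + ?P]"
    by (metis le0 mult_2 upt_add_eq_append)
  moreover have "map (bit_column b) [0..<?P] = repeat (2 ^ b) [0, 0]"
  proof -
    have "map (bit_column b) [0..<?P] = map (\<lambda>_. 0) [0..<2 ^ b * 2]"
      by (intro nth_equalityI) (auto simp: bit_column_def)
    also have "\<dots> = repeat (2 ^ b) [0, 0]"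
      by (subst map_periodic) (auto simp: two)
    finally show ?thesis .
  qed
  moreover have "map (bit_column b) [?P..<?P + ?P] = repeat (2 ^ b) [0, 1]"
  proof -
    have "map (bit_column b) [?P..<?P + ?P] = map (\<lambda>i. of_bool (odd i)) [0..<2 ^ b * 2]"
      by (intro nth_equalityI) (auto simp: bit_column_def)
    also have "\<dots> = repeat (2 ^ b) [0, 1]"
      by (subst map_periodic) (auto simp: two)
    finally show ?thesis .
  qed
  ultimately show ?thesis by (simp only: map_append)
qed

text \<open>Four rules give the short strings, \<open>b\<close> doublings each half of a period, one
  rule the period, \<open>m - Suc b\<close> doublings the column, and \<open>b\<close> doublings its
  repetition.\<close>

lemma derives_bit_column:
  assumes "b < m"
  shows "derives (4 * Suc m) {repeat (2 ^ b) (map (bit_column b) [0..<2 ^ Suc m])}"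
proof -
  have "derives 1 {[0 :: int]}" using derives.letter[OF derives.empty] by simp
  then have "derives 2 {[0 :: int], [1]}"
    using derives.letter[of 1 "{[0]}" 1] by (simp add: insert_commute numeral_2_eq_2)
  then have "derives 3 {[0, 0 :: int], [0], [1]}"
    using derives.append[of 2 "{[0], [1]}" "[0]" "[0]"] by simp
  then have "derives 4 {[0, 1], [0, 0 :: int], [0], [1]}"
    using derives.append[of 3 "{[0, 0], [0], [1]}" "[0]" "[1]"] by simp
  then have "derives (4 + b) ({[0, 1], [0, 0 :: int], [0], [1]} \<union> {repeat (2 ^ d) [0, 0] |d. d \<le> b})"
    by (rule derives_repeat) auto
  then have "derives (4 + b + b) (({[0, 1], [0, 0 :: int], [0], [1]} \<union>
      {repeat (2 ^ d) [0, 0] |d. d \<le> b}) \<union> {repeat (2 ^ d) [0, 1] |d. d \<le> b})"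
    (is "derives _ ?V")
    by (rule derives_repeat) auto
  then have "derives (Suc (4 + b + b)) (insert (repeat (2 ^ b) [0, 0] @ repeat (2 ^ b) [0, 1]) ?V)"
    by (rule derives.append) auto
  then have "derives (Suc (4 + b + b)) {repeat (2 ^ b) [0, 0 :: int] @ repeat (2 ^ b) [0, 1]}"
    by (rule derives.weaken) auto
  then have "derives (Suc (4 + b + b) + (m - Suc b)) {map (bit_column b) [0..<2 ^ Suc m]}"
    unfolding bit_column_list[OF assms] by (rule derives_repeat_single)
  then have "derives (Suc (4 + b + b) + (m - Suc b) + b)
      {repeat (2 ^ b) (map (bit_column b) [0..<2 ^ Suc m])}"
    by (rule derives_repeat_single)
  then show ?thesis by (rule derives.weaken) (use assms in auto)
qed

text \<open>The cost is only \<open>m + 2 + e\<close>; the bound matches that of the bit columns so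
  that all blocks share it.\<close>

lemma derives_constant_column:
  assumes "e \<le> m"
  shows "derives (4 * Suc m) {repeat (2 ^ e) (map (\<lambda>_. a) [0..<2 ^ Suc m])}"
proof -
  have "derives 1 {[a]}" using derives.letter[OF derives.empty] by simp
  then have "derives (1 + Suc m) {repeat (2 ^ Suc m) [a]}"
    by (rule derives_repeat_single)
  moreover have "repeat n [a] = map (\<lambda>_. a) [0..<n]" for n
    by (induction n) (auto simp: map_replicate_const replicate_append_same)
  ultimately have "derives (1 + Suc m) {map (\<lambda>_. a) [0..<2 ^ Suc m]}" by metis
  then have "derives (1 + Suc m + e) {repeat (2 ^ e) (map (\<lambda>_. a) [0..<2 ^ Suc m])}"
    by (rule derives_repeat_single)
  then show ?thesis by (rule derives.weaken) (use assms in auto)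
qed

text \<open>Captures what the column lists of \<open>A\<close> and of the transpose of
  \<open>B\<close> have in common, so that both are treated at once; they differ in the side of the
  padding.\<close>

definition admissible_runs :: "nat \<Rightarrow> ((nat \<Rightarrow> int) \<times> nat) list \<Rightarrow> bool" where
  "admissible_runs m rs \<longleftrightarrow> length rs = m + 2 \<and> length (dyadic_expand rs) = 2 ^ Suc m \<and>
     set rs \<subseteq> insert (\<lambda>_. 1, m) (set (bit_runs m))"

lemma bit_runs_entry:
  "(\<phi>, e) \<in> insert (\<lambda>_. 1, m) (set (bit_runs m)) \<Longrightarrow> \<phi> i \<in> {0, 1} \<and> e \<le> m"
  by (auto simp: bit_runs_def bit_column_def)

text \<open>Evaluating the \<open>m + 2\<close> runs of columns at a row index presents the row as
  \<open>m + 2\<close> dyadic runs over two letters.\<close>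

lemma admissible_rows:
  assumes "admissible_runs m rs" "w \<in> set (rows (column_mat (dyadic_expand rs)))"
  shows "\<exists>ps. run_length_encoding (list_of_vec w) ps \<and> rle_size ps \<le> m + 2"
    and "\<exists>G. grammar_compression (list_of_vec w) G \<and> slp_size G \<le> 4 * Suc m"
proof -
  have "list_of_vec w \<in> set (map list_of_vec (rows (column_mat (dyadic_expand rs))))"
    using assms(2) by simp
  then obtain i where "list_of_vec w = map (\<lambda>\<phi>. \<phi> i) (dyadic_expand rs)"
    unfolding rows_column_mat by auto
  then have w: "list_of_vec w = dyadic_expand (map (apfst (\<lambda>\<phi>. \<phi> i)) rs)"
    by (simp add: map_dyadic_expand)
  have len: "length rs = m + 2" using assms by (simp add: admissible_runs_def)
  show "\<exists>ps. run_length_encoding (list_of_vec w) ps \<and> rle_size ps \<le> m + 2"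
    using rle_dyadic_expand[of "map (apfst (\<lambda>\<phi>. \<phi> i)) rs"] len w by simp
  have "set (map (apfst (\<lambda>\<phi>. \<phi> i)) rs) \<subseteq> set [0, 1] \<times> {..m}"
    using assms(1) bit_runs_entry unfolding admissible_runs_def by fastforce
  from grammar_dyadic_expand[OF _ this] len w
  obtain G where "grammar_compression (list_of_vec w) G" "slp_size G \<le> (m + 1) * 2 + (m + 2)"
    by force
  then show "\<exists>G. grammar_compression (list_of_vec w) G \<and> slp_size G \<le> 4 * Suc m"
    by (intro exI[of _ G]) auto
qed

text \<open>Read column by column, the matrix consists of \<open>m + 2\<close> blocks, each a single
  column repeated a power of two times. A block costs at most \<open>4 * Suc m\<close> rules, and
  joining the blocks at most \<open>m + 2\<close>.\<close>

lemma admissible_strong_compression: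
  assumes "admissible_runs m rs"
  shows "\<exists>S. strong_compression (column_mat (dyadic_expand rs)) S \<and> slp_size S \<le> 10 * (Suc m)\<^sup>2"
proof -
  let ?D = "dyadic_expand rs"
  let ?block = "\<lambda>(\<phi>, e). repeat (2 ^ e) (map \<phi> [0..<2 ^ Suc m])"
  have len: "length rs = m + 2" "length ?D = 2 ^ Suc m"
    using assms by (auto simp: admissible_runs_def)
  have "derives (4 * Suc m) {?block r}" if "r \<in> set rs" for r
  proof -
    have "r \<in> insert (\<lambda>_. 1, m) (set (bit_runs m))"
      using that assms by (auto simp: admissible_runs_def)
    then consider "r = (\<lambda>_. 1, m)" | "r = (\<lambda>_. 0, 0)" | b where "b < m" "r = (bit_column b, b)"
      by (auto simp: bit_runs_def)
    then show ?thesis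
    proof cases
      case 1
      then show ?thesis using derives_constant_column[of m m 1] by simp
    next
      case 2
      then show ?thesis using derives_constant_column[of 0 m 0] by simp
    next
      case 3
      then show ?thesis using derives_bit_column by simp
    qed
  qed
  then have "derives (4 * Suc m * length rs) (\<Union>r \<in> set rs. {?block r})"
    by (rule derives_UN)
  then have "derives (4 * Suc m * length rs + length (map ?block rs))
      (insert (concat (map ?block rs)) (\<Union>r \<in> set rs. {?block r}))"
    by (rule derives_concat) (use len in auto)
  moreover have "concat (map ?block rs) = row_concatenation (transpose_mat (column_mat ?D))"
    unfolding row_concatenation_transpose_column_mat concat_map_dyadic_expand len ..
  ultimately obtain H where H:
    "grammar_compression (row_concatenation (transpose_mat (column_mat ?D))) H"
    "slp_size H \<le> 4 * Suc m * (m + 2) + (m + 2)"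
    using derives_grammar len by (metis insertI1 length_map)
  have "row_concatenation (column_mat ?D) \<noteq> []"
    unfolding row_concatenation_def rows_column_mat using len
    by (auto simp del: power_Suc intro: exI[of _ 0])
  from strong_compression_exists[OF this H(1)]
  obtain S where "strong_compression (column_mat ?D) S" "slp_size S \<le> slp_size H" by blast
  moreover have "4 * Suc m * (m + 2) + (m + 2) \<le> 10 * (Suc m)\<^sup>2"
    by (simp add: power2_eq_square algebra_simps)
  ultimately show ?thesis using H(2) by (meson order_trans)
qed

section \<open>The product\<close>

definition height_sum_mat :: "nat \<Rightarrow> int mat" where
  "height_sum_mat n = mat n n (\<lambda>(i, j). int (height i + height j))"

lemma height_odd [simp]: "height (Suc (2 * a)) = a" "height (2 * a) = 0"
  by (simp_all add: height_def)

lemma transpose_height_sum_mat: "transpose_mat (height_sum_mat n) = height_sum_mat n"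
  by (intro eq_matI) (auto simp: height_sum_mat_def)

text \<open>In each half of the scalar product one of the two factors is constantly
  \<open>1\<close>, which leaves the row sums \<open>height i\<close> and
  \<open>height j\<close>.\<close>

lemma product_eq_height_sum_mat:
  "column_mat (dyadic_expand (bit_runs m @ [(\<lambda>_. 1, m)])) *
   transpose_mat (column_mat (dyadic_expand ((\<lambda>_. 1, m) # bit_runs m))) =
   height_sum_mat (2 ^ Suc m)"
proof -
  define U where "U = dyadic_expand (bit_runs m)"
  define O1 :: "(nat \<Rightarrow> int) list" where "O1 = replicate (2 ^ m) (\<lambda>_. 1)"
  have len: "length U = 2 ^ m" "length O1 = 2 ^ m"
    by (simp_all add: U_def O1_def length_dyadic_expand_bit_runs)
  have "(\<Sum>c = 0..<2 ^ Suc m. ((U @ O1) ! c) i * ((O1 @ U) ! c) j) = int (height i + height j)"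
    if "i < 2 ^ Suc m" "j < 2 ^ Suc m" for i j
  proof -
    \<comment> \<open>Writing the lower bound as \<open>0 + 2 ^ m\<close> lets
      \<open>sum.shift_bounds_nat_ivl\<close> move the right half back to start at
      \<open>0\<close>.\<close>
    have "(\<Sum>c = 0..<2 ^ Suc m. ((U @ O1) ! c) i * ((O1 @ U) ! c) j) =
      (\<Sum>c = 0..<2 ^ m. ((U @ O1) ! c) i * ((O1 @ U) ! c) j) +
      (\<Sum>c = 0 + 2 ^ m..<2 ^ m + 2 ^ m. ((U @ O1) ! c) i * ((O1 @ U) ! c) j)"
      by (simp add: sum.atLeastLessThan_concat mult_2)
    also have "\<dots> = (\<Sum>c = 0..<2 ^ m. (U ! c) i) + (\<Sum>c = 0..<2 ^ m. (U ! c) j)"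
      unfolding sum.shift_bounds_nat_ivl
      by (intro arg_cong2[of _ _ _ _ "(+)"] sum.cong)
         (auto simp: nth_append len, auto simp: O1_def)
    also have "\<dots> = sum_list (map (\<lambda>\<phi>. \<phi> i) U) + sum_list (map (\<lambda>\<phi>. \<phi> j) U)"
      by (simp add: sum_list_sum_nth len)
    finally show ?thesis
      using sum_list_bit_runs that by (simp add: U_def)
  qed
  then show ?thesis
    by (intro eq_matI)
       (auto simp: column_mat_def height_sum_mat_def scalar_prod_def len mult_2
             simp flip: U_def O1_def)
qed

section \<open>Lower bounds for the product\<close>

text \<open>The odd columns \<open>2a + 1\<close> alone contribute the distinct entries
  \<open>height i + a\<close>.\<close>

lemma card_row_height_sum_mat:
  assumes "w \<in> set (rows (height_sum_mat (2 ^ Suc m)))"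
  shows "2 ^ m \<le> card (set (list_of_vec w))"
proof -
  obtain i where i: "i < 2 ^ Suc m" "w = row (height_sum_mat (2 ^ Suc m)) i"
    using assms by (auto simp: rows_def height_sum_mat_def)
  have "(\<lambda>a. int (height i + a)) ` {..<2 ^ m} \<subseteq> set (list_of_vec w)"
  proof
    fix x assume "x \<in> (\<lambda>a. int (height i + a)) ` {..<2 ^ m}"
    then obtain a where a: "a < 2 ^ m" "x = int (height i + a)" by auto
    then have "list_of_vec w ! Suc (2 * a) = x" "Suc (2 * a) < length (list_of_vec w)"
      using i by (auto simp: height_sum_mat_def)
    then show "x \<in> set (list_of_vec w)" by (metis nth_mem)
  qed
  then have "card ((\<lambda>a. int (height i + a)) ` {..<2 ^ m :: nat}) \<le> card (set (list_of_vec w))"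
    by (intro card_mono) auto
  then show ?thesis by (subst (asm) card_image) (auto simp: inj_on_def)
qed

lemma rowwise_compression_height_sum_mat:
  assumes "rowwise_compression (height_sum_mat (2 ^ Suc m)) Gs"
  shows "2 ^ Suc m * 2 ^ m \<le> total_size Gs"
proof -
  let ?R = "rows (height_sum_mat (2 ^ Suc m))"
  have all: "list_all2 (\<lambda>w G. grammar_compression (list_of_vec w) G) ?R Gs"
    using assms by (simp add: rowwise_compression_def list_all2_map1)
  have ge: "2 ^ m \<le> slp_size G" if G: "G \<in> set Gs" for G
  proof -
    obtain i where i: "i < length Gs" "G = Gs ! i"
      using G by (auto simp: in_set_conv_nth)
    then have "grammar_compression (list_of_vec (?R ! i)) G"
      using list_all2_nthD2[OF all] by blast
    moreover have "?R ! i \<in> set ?R"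
      using i list_all2_lengthD[OF all] by (intro nth_mem) simp
    ultimately show ?thesis
      using card_row_height_sum_mat grammar_size_ge_letters order_trans by blast
  qed
  have "length Gs = 2 ^ Suc m"
    using list_all2_lengthD[OF all] by (simp add: height_sum_mat_def)
  then have "2 ^ Suc m * 2 ^ m = sum_list (map (\<lambda>_. 2 ^ m :: nat) Gs)"
    by (simp add: sum_list_triv)
  also have "\<dots> \<le> total_size Gs"
    unfolding total_size_def by (intro sum_list_mono ge)
  finally show ?thesis .
qed

lemma nth_row_concatenation:
  assumes "i < dim_row M" "j < dim_col M"
  shows "row_concatenation M ! (i * dim_col M + j) = M $$ (i, j)"
    and "i * dim_col M + j < length (row_concatenation M)"
proof -
  have *: "i < length xss \<Longrightarrow> j < n \<Longrightarrow> \<forall>xs \<in> set xss. length xs = n \<Longrightarrow>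
      concat xss ! (i * n + j) = xss ! i ! j \<and> i * n + j < length (concat xss)"
    for xss :: "'a list list" and n
  proof (induction xss arbitrary: i)
    case (Cons xs xss)
    then show ?case by (cases i) (auto simp: nth_append add.assoc)
  qed simp
  show "row_concatenation M ! (i * dim_col M + j) = M $$ (i, j)"
    "i * dim_col M + j < length (row_concatenation M)"
    using *[of "map list_of_vec (rows M)" "dim_col M"] assms
    by (auto simp: row_concatenation_def rows_def)
qed

text \<open>The heights vanish at even indices, so the entries in row \<open>2a + 1\<close> and columns
  \<open>2b\<close>, \<open>2b + 1\<close> are \<open>a\<close> and \<open>a + b\<close>, a pair which determines \<open>a\<close> and \<open>b\<close>.\<close>

lemma grammar_height_sum_mat:
  assumes "grammar_compression (row_concatenation (height_sum_mat (2 ^ Suc m))) G"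
  shows "2 ^ m * 2 ^ m \<le> slp_size G"
proof -
  let ?n = "2 ^ Suc m :: nat"
  let ?M = "height_sum_mat ?n"
  let ?f = "\<lambda>(a, b). (int a, int (a + b))"
  let ?X = "{..<2 ^ m :: nat} \<times> {..<2 ^ m :: nat}"
  have dim: "dim_row ?M = ?n" "dim_col ?M = ?n" by (simp_all add: height_sum_mat_def)
  have "?f ` ?X \<subseteq> adjacent_pairs (row_concatenation ?M)"
  proof (clarify)
    fix a b :: nat assume ab: "a < 2 ^ m" "b < 2 ^ m"
    \<comment> \<open>The row-major position of entry \<open>(2a + 1, 2b)\<close>. Position
      \<open>Suc ?p\<close> stays in the same row because \<open>2b + 1 < ?n\<close>.\<close>
    let ?p = "Suc (2 * a) * ?n + 2 * b"
    have lt: "Suc (2 * a) < ?n" "2 * b < ?n" "Suc (2 * b) < ?n" using ab by auto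
    have "row_concatenation ?M ! ?p = ?M $$ (Suc (2 * a), 2 * b)"
      using nth_row_concatenation(1)[of "Suc (2 * a)" ?M "2 * b"] lt dim by metis
    moreover have "row_concatenation ?M ! Suc ?p = ?M $$ (Suc (2 * a), Suc (2 * b))"
      using nth_row_concatenation(1)[of "Suc (2 * a)" ?M "Suc (2 * b)"] lt dim
      by (metis add_Suc_right)
    moreover have "Suc ?p < length (row_concatenation ?M)"
      using nth_row_concatenation(2)[of "Suc (2 * a)" ?M "Suc (2 * b)"] lt dim
      by (metis add_Suc_right)
    moreover have "?M $$ (Suc (2 * a), 2 * b) = int a"
      "?M $$ (Suc (2 * a), Suc (2 * b)) = int (a + b)"
      using lt by (simp_all add: height_sum_mat_def)
    ultimately show "(int a, int (a + b)) \<in> adjacent_pairs (row_concatenation ?M)"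
      unfolding adjacent_pairs_def by (intro CollectI exI[of _ ?p]) simp
  qed
  then have "card (?f ` ?X) \<le> card (adjacent_pairs (row_concatenation ?M))"
    by (intro card_mono finite_adjacent_pairs)
  moreover have "card (?f ` ?X) = 2 ^ m * 2 ^ m"
    by (subst card_image) (auto simp: inj_on_def)
  ultimately show ?thesis using grammar_size_ge_adjacent_pairs[OF assms] by simp
qed

section \<open>Choice of the two matrices and transfer of the bounds to the reals\<close>

theorem theorem3:
  "\<exists>K > 0. \<exists>c > (0::real). \<exists>\<^sub>\<infinity>N::nat. \<exists>A B :: int mat.
     A \<in> carrier_mat N N \<and> B \<in> carrier_mat N N \<and>
     elements_mat A \<subseteq> {0, 1} \<and> elements_mat B \<subseteq> {0, 1} \<and>
     (\<forall>w \<in> set (rows A) \<union> set (cols B).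
        (\<exists>ps. run_length_encoding (list_of_vec w) ps \<and> real (rle_size ps) \<le> K * log 2 N) \<and>
        (\<exists>G. grammar_compression (list_of_vec w) G \<and> real (slp_size G) \<le> K * log 2 N)) \<and>
     (\<exists>P. convenient_compression A B P \<and> real (convenient_size P) \<le> K * (N * log 2 N)) \<and>
     (\<exists>S. strong_compression A S \<and> real (slp_size S) \<le> K * (log 2 N)\<^sup>2) \<and>
     (\<exists>S. strong_compression B S \<and> real (slp_size S) \<le> K * (log 2 N)\<^sup>2) \<and>
     (\<forall>Gs. rowwise_compression (A * B) Gs \<longrightarrow>
        real (total_size Gs) \<ge> c * (real N ^ 2 / (log 2 N)\<^sup>2)) \<and>
     (\<forall>Gs. columnwise_compression (A * B) Gs \<longrightarrow>
        real (total_size Gs) \<ge> c * (real N ^ 2 / (log 2 N)\<^sup>2)) \<and>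
     (\<forall>S. strong_compression (A * B) S \<longrightarrow>
        real (slp_size S) \<ge> c * (real N ^ 2 / (log 2 N)\<^sup>2))"
  (is "\<exists>K > 0. \<exists>c > 0. \<exists>\<^sub>\<infinity>N. \<exists>A B. ?P K c N A B")
proof -
  \<comment> \<open>The constant \<open>10\<close> is the one of the strong compressions; the other
    upper bounds need at most \<open>8\<close>. The constant \<open>1 / 4\<close> reflects
    \<open>2 ^ m * 2 ^ m = N^2 / 4\<close>.\<close>
  have main: "\<exists>A B. ?P 10 (1 / 4) N A B" if N: "N = 2 ^ Suc m" for N m
  proof -
    define ra where "ra = bit_runs m @ [(\<lambda>_. 1, m)]"
    define rb where "rb = (\<lambda>_. 1, m) # bit_runs m"
    define A where "A = column_mat (dyadic_expand ra)"
    \<comment> \<open>The right factor is the transpose of \<open>B'\<close>, so its columns are the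
      rows of \<open>B'\<close> and the row lemmas apply to both factors.\<close>
    define B' where "B' = column_mat (dyadic_expand rb)"
    have adm: "admissible_runs m ra" "admissible_runs m rb"
      by (auto simp: admissible_runs_def ra_def rb_def length_dyadic_expand_bit_runs)
         (auto simp: bit_runs_def)
    have car: "A \<in> carrier_mat N N" "B' \<in> carrier_mat N N"
      using column_mat_carrier adm N unfolding A_def B'_def admissible_runs_def by metis+
    have elem: "elements_mat (column_mat (dyadic_expand rs)) \<subseteq> {0, 1}"
      if "admissible_runs m rs" for rs
    proof
      fix x assume "x \<in> elements_mat (column_mat (dyadic_expand rs))"
      then obtain c i where "x = (dyadic_expand rs ! c) i" "c < length (dyadic_expand rs)"
        by (auto simp: elements_mat_def column_mat_def)
      moreover
      have "\<phi> i \<in> {0, 1}" if "\<phi> \<in> set (dyadic_expand rs)" for \<phi> i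
        using that \<open>admissible_runs m rs\<close> bit_runs_entry
        unfolding set_dyadic_expand admissible_runs_def by fastforce
      ultimately show "x \<in> {0, 1}" by (metis nth_mem)
    qed
    have "elements_mat (transpose_mat B') \<subseteq> elements_mat B'"
      by (auto simp: elements_mat_def)
    then have elemB: "elements_mat (transpose_mat B') \<subseteq> {0, 1}"
      using elem[OF adm(2)] by (simp add: B'_def)
    have lg: "log 2 (real N) = real (Suc m)" by (simp add: N log_nat_power del: power_Suc)
    have rows: "\<exists>ps. run_length_encoding (list_of_vec w) ps \<and> rle_size ps \<le> m + 2"
      "\<exists>G. grammar_compression (list_of_vec w) G \<and> slp_size G \<le> 4 * Suc m"
      if "w \<in> set (rows A) \<union> set (rows B')" for w
      using that admissible_rows adm unfolding A_def B'_def by blast+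
    have rows': "(\<exists>ps. run_length_encoding (list_of_vec w) ps \<and> real (rle_size ps) \<le> 10 * log 2 N) \<and>
        (\<exists>G. grammar_compression (list_of_vec w) G \<and> real (slp_size G) \<le> 10 * log 2 N)"
      if w: "w \<in> set (rows A) \<union> set (rows B')" for w
    proof -
      obtain ps G where "run_length_encoding (list_of_vec w) ps" "rle_size ps \<le> m + 2"
        "grammar_compression (list_of_vec w) G" "slp_size G \<le> 4 * Suc m"
        using rows[OF w] by blast
      then show ?thesis unfolding lg by (intro conjI exI[of _ ps] exI[of _ G]) auto
    qed
    obtain Gs Hs where GH: "rowwise_compression A Gs" "total_size Gs \<le> N * (4 * Suc m)"
      "rowwise_compression B' Hs" "total_size Hs \<le> N * (4 * Suc m)"
      using rowwise_compression_of_size[OF rows(2)] car by (metis UnCI carrier_matD(1))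
    then have conv: "convenient_compression A (transpose_mat B') (Gs, Hs)"
      by (simp add: convenient_compression_def columnwise_compression_def
          rowwise_compression_def)
    have "convenient_size (Gs, Hs) \<le> N * (4 * Suc m) + N * (4 * Suc m)"
      using GH by (auto simp: convenient_size_def intro: add_mono)
    then have "real (convenient_size (Gs, Hs)) \<le> real (10 * (N * Suc m))"
      by (intro of_nat_mono) (simp add: algebra_simps)
    then have convs: "real (convenient_size (Gs, Hs)) \<le> 10 * (N * log 2 N)"
      unfolding lg by (simp add: algebra_simps)
    have strong: "\<exists>S. strong_compression (column_mat (dyadic_expand rs)) S \<and>
        real (slp_size S) \<le> 10 * (log 2 N)\<^sup>2" if adm: "admissible_runs m rs" for rs
    proof -
      obtain S where S: "strong_compression (column_mat (dyadic_expand rs)) S"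
        "slp_size S \<le> 10 * (Suc m)\<^sup>2"
        using admissible_strong_compression[OF adm] by blast
      then have "real (slp_size S) \<le> real (10 * (Suc m)\<^sup>2)" by (intro of_nat_mono)
      then show ?thesis using S(1) unfolding lg by auto
    qed
    have prod: "A * transpose_mat B' = height_sum_mat N"
      unfolding A_def B'_def ra_def rb_def N by (rule product_eq_height_sum_mat)
    \<comment> \<open>Since \<open>log 2 N = m + 1\<close> is at least \<open>1\<close>, dividing by
      its square only weakens the bound \<open>N^2 / 4\<close>.\<close>
    have bound: "real n \<ge> 1 / 4 * (real N ^ 2 / (log 2 N)\<^sup>2)" if "2 ^ m * 2 ^ m \<le> n" for n :: nat
    proof -
      have "(1 :: real) \<le> (log 2 N)\<^sup>2" unfolding lg by simp
      then have "real N ^ 2 / (log 2 N)\<^sup>2 \<le> real N ^ 2"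
        by (simp add: divide_le_eq mult_le_cancel_left1)
      also have "\<dots> = 4 * real (2 ^ m * 2 ^ m)" by (simp add: N power2_eq_square)
      also have "\<dots> \<le> 4 * real n" using that by (intro mult_left_mono of_nat_mono) auto
      finally show ?thesis by simp
    qed
    have row_bound: "real (total_size Gs) \<ge> 1 / 4 * (real N ^ 2 / (log 2 N)\<^sup>2)"
      if "rowwise_compression (height_sum_mat N) Gs" for Gs
      using rowwise_compression_height_sum_mat[of m Gs] that by (intro bound) (simp add: N)
    have col_bound: "real (total_size Gs) \<ge> 1 / 4 * (real N ^ 2 / (log 2 N)\<^sup>2)"
      if "columnwise_compression (height_sum_mat N) Gs" for Gs
      using that row_bound rows_transpose[of "height_sum_mat N"]
      by (simp add: columnwise_compression_def rowwise_compression_def transpose_height_sum_mat)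
    \<comment> \<open>By symmetry of the product both grammars in a strong compression generate the
      same string, so either choice of \<open>S\<close> obeys the grammar bound.\<close>
    have strong_bound: "real (slp_size S) \<ge> 1 / 4 * (real N ^ 2 / (log 2 N)\<^sup>2)"
      if "strong_compression (height_sum_mat N) S" for S
      using that unfolding strong_compression_def transpose_height_sum_mat N
      by (intro bound[unfolded N] grammar_height_sum_mat) auto
    have car': "transpose_mat B' \<in> carrier_mat N N" using car(2) by simp
    have rows'': "\<forall>w \<in> set (rows A) \<union> set (cols (transpose_mat B')).
        (\<exists>ps. run_length_encoding (list_of_vec w) ps \<and> real (rle_size ps) \<le> 10 * log 2 N) \<and>
        (\<exists>G. grammar_compression (list_of_vec w) G \<and> real (slp_size G) \<le> 10 * log 2 N)"
      using rows' by simp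
    have strong': "\<exists>S. strong_compression (transpose_mat B') S \<and>
        real (slp_size S) \<le> 10 * (log 2 N)\<^sup>2"
      using strong[OF adm(2), folded B'_def] strong_compression_transpose by blast
    have "?P 10 (1 / 4) N A (transpose_mat B')"
      unfolding prod
      by (intro conjI allI impI car(1) car' elem[OF adm(1), folded A_def] elemB rows''
          exI[of _ "(Gs, Hs)"] conv convs strong[OF adm(1), folded A_def] strong'
          row_bound col_bound strong_bound)
    then show ?thesis by (intro exI)
  qed
  have inf: "\<exists>\<^sub>\<infinity>N. \<exists>A B. ?P 10 (1 / 4) N A B"
    unfolding INFM_nat
  proof (intro allI, rule exI, rule conjI)
    fix n :: nat
    show "n < 2 ^ Suc n" by (metis less_exp less_trans lessI)
    show "\<exists>A B. ?P 10 (1 / 4) (2 ^ Suc n) A B" by (rule main[OF refl])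
  qed
  have const: "\<exists>c > 0. \<exists>\<^sub>\<infinity>N. \<exists>A B. ?P 10 c N A B"
    by (rule exI[of _ "1 / 4"], rule conjI[OF _ inf]) simp
  show ?thesis
    by (rule exI[of _ 10], rule conjI[OF _ const]) simp
qed

end
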